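(* Let $1<N\in\mathbb{N}$. Let $\mathbb{X}$ be a nonempty connected closed subset of a complete metric space, with metric $d_{\mathbb{X}}$, let $(\mathbb{Y},d_{\mathbb{Y}})$ be a complete metric space, and let $\{\mathbb{X}_i\mid i=1,\dots,N\}$ be a family of nonempty connected subsets of $\mathbb{X}$. Let $u_i:\mathbb{X}_i\to\mathbb{X}$, $i=1,\dots,N$, be Lipschitz mappings with Lipschitz constants $a_i$, each a bijection onto its image, such that $\mathbb{X}=\bigcup_{i=1}^N u_i(\mathbb{X}_i)$ and $u_i(\mathbb{X}_i)\cap u_j(\mathbb{X}_j)=\emptyset$ for all $i\neq j$, and put $a:=\max\{a_i\mid i=1,\dots,N\}$. Let $v_i:\mathbb{X}_i\times\mathbb{Y}\to\mathbb{Y}$, $i=1,\dots,N$, be mappings that are uniformly contractive in the second variable and uniformly Lipschitz continuous in the first variable, i.e., there exist $\ell\in[0,1)$ and $L>0$ such that for all $i=1,\dots,N$ $$d_{\mathbb{Y}}(v_i(x,y_1),v_i(x,y_2))\le\ell\,d_{\mathbb{Y}}(y_1,y_2)\quad\forall x\in\mathbb{X}_i,\ \forall y_1,y_2\in\mathbb{Y},$$ $$d_{\mathbb{Y}}(v_i(x_1,y),v_i(x_2,y))\le L\,d_{\mathbb{X}}(x_1,x_2)\quad\forall x_1,x_2\in\mathbb{X}_i,\ \forall y\in\mathbb{Y}.$$ Let $\Phi$ be the Read-Bajactarević operator defined for $f\in B(\mathbb{X},\mathbb{Y})$ by $$\Phi f(x):=\sum_{i=1}^N v_i\big(u_i^{-1}(x),f_i\circ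 u_i^{-1}(x)\big)\,\chi_{u_i(\mathbb{X}_i)}(x),\qquad f_i:=f|_{\mathbb{X}_i},$$ and let $f^*\in B(\mathbb{X},\mathbb{Y})$ be its unique fixed point (the local fractal function associated with $\Phi$). Define $w_i:\mathbb{X}_i\times\mathbb{Y}\to\mathbb{X}\times\mathbb{Y}$ by $w_i(x,y):=(u_i(x),v_i(x,y))$, $i=1,\dots,N$, put $\theta:=\frac{1-a}{2L}$, and define $d_\theta:(\mathbb{X}\times\mathbb{Y})\times(\mathbb{X}\times\mathbb{Y})\to\mathbb{R}$ by $d_\theta:=d_{\mathbb{X}}+\theta\,d_{\mathbb{Y}}$. Then the family $\mathcal{W}_{\mathrm{loc}}:=\{\mathbb{X}\times\mathbb{Y};(\mathbb{X}_i\times\mathbb{Y},w_i)\mid i=1,\dots,N\}$ is a contractive local IFS in the metric $d_\theta$, and the graph $G(f^* )$ of the local fractal function $f^*$ is an attractor of $\mathcal{W}_{\mathrm{loc}}$. Moreover, $$G(\Phi f^* )=\mathcal{W}_{\mathrm{loc}}(G(f^* )),$$ where on the right $\mathcal{W}_{\mathrm{loc}}$ denotes the set-valued operator associated with the local IFS $\mathcal{W}_{\mathrm{loc}}$.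
   Context: $B(\mathbb{X},\mathbb{Y})$ is the set of functions $f:\mathbb{X}\to\mathbb{Y}$ that are bounded, i.e. for which there is $M>0$ with $d_{\mathbb{Y}}(f(x_1),f(x_2))<M$ for all $x_1,x_2\in\mathbb{X}$, with the complete metric $d(f,g)=\sup_{x\in\mathbb{X}}d_{\mathbb{Y}}(f(x),g(x))$. In the formula for $\Phi$, $\chi_M$ is the indicator function of $M$ and the sum is a piecewise definition: $\Phi f(x)=v_i(u_i^{-1}(x),f(u_i^{-1}(x)))$ for $x\in u_i(\mathbb{X}_i)$. In the paper it is asserted, as a consequence of the boundedness of $f$ and the contractivity of the $v_i$ in the second variable, that $\Phi$ maps $B(\mathbb{X},\mathbb{Y})$ into itself and is a contraction there with constant $\ell$, so that by the Banach Fixed Point Theorem it has a unique fixed point $f^*$. The paper likewise asserts that $d_\theta$, as defined in the claim, is a metric on $\mathbb{X}\times\mathbb{Y}$ compatible with the product topology. $G(f):=\{(x,f(x))\mid x\in\mathbb{X}\}$ is the graph of $f$. A local IFS (local iterated function system) on a complete metric space $\mathbb{Z}$ is a family $\{\mathbb{Z};(\mathbb{Z}_i,g_i)\mid i=1,\dots,N\}$ with $\mathbb{Z}_i\subseteq\mathbb{Z}$ nonempty and $g_i:\mathbb{Z}_i\to\mathbb{Z}$ continuous. It is contractive if there is a metric $\rho$ equivalent to the given one with respect to which every $g_i$ is contractive on its domain, i.e. for each $i$ there is $s\in[0,1)$ with $\rho(g_i(z_1),g_i(z_2))\le s\,\rho(z_1,z_2)$ for all $z_1,z_2\in\mathbb{Z}_i$;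 one then says it is contractive in the metric $\rho$. Its associated set-valued operator, denoted by the same symbol as the local IFS, sends $S\subseteq\mathbb{Z}$ to $\bigcup_{i=1}^N g_i(S\cap\mathbb{Z}_i)$. A set $A\subseteq\mathbb{Z}$ is a (local) attractor of the local IFS if it is a fixed point of this operator.
   Formalization: The hypothesis a < 1 is added: if a ≥ 1 then θ ≤ 0, so d_θ is not a metric once Y has two points, and for one-point Y the maps w_i need not be contractive (e.g. u_i(x) = 2x on [0,1/4) and [1/4,1/2], X = [0,1]). *)

theory Defs
  imports "HOL-Analysis.Analysis"
begin

section \<open>Local iterated function systems\<close>

text \<open>A finite family \<open>{Z; (Zs i, g i) | i = 1..N}\<close> is given by \<open>Z\<close>, \<open>N\<close>, \<open>Zs\<close> and \<open>g\<close>.  Only the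
  values of \<open>g i\<close> on \<open>Zs i\<close> matter; outside \<open>Zs i\<close> the HOL function is arbitrary.\<close>

definition local_IFS ::
    "'z::metric_space set \<Rightarrow> nat \<Rightarrow> (nat \<Rightarrow> 'z set) \<Rightarrow> (nat \<Rightarrow> 'z \<Rightarrow> 'z) \<Rightarrow> bool" where
  "local_IFS Z N Zs g \<longleftrightarrow> complete Z \<and>
     (\<forall>i\<in>{1..N}. Zs i \<subseteq> Z \<and> Zs i \<noteq> {} \<and> g i ` Zs i \<subseteq> Z \<and> continuous_on (Zs i) (g i))"

text \<open>Equivalence of metrics is topological: the metric \<open>\<rho>\<close> on \<open>Z\<close> induces the topology that \<open>Z\<close>
  carries as a subspace of its ambient type.\<close>

definition equivalent_metric_on ::
    "'z::metric_space set \<Rightarrow> ('z \<Rightarrow> 'z \<Rightarrow> real) \<Rightarrow> bool" where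
  "equivalent_metric_on Z \<rho> \<longleftrightarrow>
     Metric_space Z \<rho> \<and> Metric_space.mtopology Z \<rho> = top_of_set Z"

definition contractive_local_IFS_in ::
    "'z::metric_space set \<Rightarrow> nat \<Rightarrow> (nat \<Rightarrow> 'z set) \<Rightarrow> (nat \<Rightarrow> 'z \<Rightarrow> 'z) \<Rightarrow>
     ('z \<Rightarrow> 'z \<Rightarrow> real) \<Rightarrow> bool" where
  "contractive_local_IFS_in Z N Zs g \<rho> \<longleftrightarrow>
     local_IFS Z N Zs g \<and> equivalent_metric_on Z \<rho> \<and>
     (\<forall>i\<in>{1..N}. \<exists>s. 0 \<le> s \<and> s < 1 \<and>
        (\<forall>z1\<in>Zs i. \<forall>z2\<in>Zs i. \<rho> (g i z1) (g i z2) \<le> s * \<rho> z1 z2))"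

definition local_IFS_operator ::
    "nat \<Rightarrow> (nat \<Rightarrow> 'z set) \<Rightarrow> (nat \<Rightarrow> 'z \<Rightarrow> 'z) \<Rightarrow> 'z set \<Rightarrow> 'z set" where
  "local_IFS_operator N Zs g S = (\<Union>i\<in>{1..N}. g i ` (S \<inter> Zs i))"

definition local_IFS_attractor ::
    "'z set \<Rightarrow> nat \<Rightarrow> (nat \<Rightarrow> 'z set) \<Rightarrow> (nat \<Rightarrow> 'z \<Rightarrow> 'z) \<Rightarrow> 'z set \<Rightarrow> bool" where
  "local_IFS_attractor Z N Zs g A \<longleftrightarrow> A \<subseteq> Z \<and> local_IFS_operator N Zs g A = A"


section \<open>Bounded functions and the Read-Bajactarevic operator\<close>

text \<open>Functions on \<open>X\<close> are taken to be \<^const>\<open>extensional\<close>, so that HOL equality is equality of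
  functions with domain \<open>X\<close>.\<close>

definition bounded_functions :: "'a set \<Rightarrow> ('a \<Rightarrow> 'b::metric_space) set" where
  "bounded_functions X = {f. f \<in> extensional X \<and> bounded (f ` X)}"

text \<open>The sum with indicator functions is a piecewise definition: the images \<open>u i ` Xs i\<close> partition
  \<open>X\<close>, so each \<open>x \<in> X\<close> determines the index \<open>i\<close> of the only nonvanishing term.  A value of \<open>Y\<close> need
  not be summable, as \<open>Y\<close> is only a metric space.\<close>

definition RB_operator ::
    "'a set \<Rightarrow> nat \<Rightarrow> (nat \<Rightarrow> 'a set) \<Rightarrow> (nat \<Rightarrow> 'a \<Rightarrow> 'a) \<Rightarrow> (nat \<Rightarrow> 'a \<times> 'b \<Rightarrow> 'b) \<Rightarrow>
     ('a \<Rightarrow> 'b) \<Rightarrow> 'a \<Rightarrow> 'b" where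
  "RB_operator X N Xs u v f = (\<lambda>x\<in>X.
     let i = (THE i. i \<in> {1..N} \<and> x \<in> u i ` Xs i);
         t = the_inv_into (Xs i) (u i) x
     in v i (t, f t))"

definition graph_on :: "'a set \<Rightarrow> ('a \<Rightarrow> 'b) \<Rightarrow> ('a \<times> 'b) set" where
  "graph_on X f = {(x, f x) | x. x \<in> X}"

definition w_map ::
    "(nat \<Rightarrow> 'a \<Rightarrow> 'a) \<Rightarrow> (nat \<Rightarrow> 'a \<times> 'b \<Rightarrow> 'b) \<Rightarrow> nat \<Rightarrow> 'a \<times> 'b \<Rightarrow> 'a \<times> 'b" where
  "w_map u v i = (\<lambda>(x, y). (u i x, v i (x, y)))"

definition d_theta ::
    "real \<Rightarrow> 'a::metric_space \<times> 'b::metric_space \<Rightarrow> 'a \<times> 'b \<Rightarrow> real" where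
  "d_theta \<theta> = (\<lambda>(x1, y1) (x2, y2). dist x1 x2 + \<theta> * dist y1 y2)"

end

theory Submission
  imports Defs
begin

text \<open>
  Moving the first coordinate of a point of \<open>X\<^sub>i \<times> Y\<close> by \<open>d\<close> moves its image under \<open>w\<^sub>i\<close> by at most
  \<open>a d\<close> in the first coordinate and \<open>L d\<close> in the second; a move of the second coordinate stays there
  and shrinks by the factor \<open>\<l>\<close>.  The constant \<open>L\<close> may be large, but with weight
  \<open>\<theta> = (1 - a) / (2 L)\<close> on the second coordinate it contributes only \<open>\<theta> L = (1 - a) / 2\<close>, half of
  the slack \<open>1 - a\<close> that \<open>u\<^sub>i\<close> leaves.  So every \<open>w\<^sub>i\<close> contracts \<open>d\<^sub>\<theta>\<close> by
  \<open>max ((1 + a) / 2) \<l>\<close> (\<open>w_map_contracts_d_theta\<close>).  As \<open>d\<^sub>\<theta>\<close> is bounded above and below by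
  multiples of the product metric, it gives the product topology, and contractivity gives continuity.

  The graph identity holds for every function \<open>f\<close>, not just for the fixed point
  (\<open>graph_on_RB_operator\<close>): the images \<open>u\<^sub>i(X\<^sub>i)\<close> partition \<open>X\<close>, and over the point \<open>u\<^sub>i(t)\<close> both sides
  have the single point \<open>(u\<^sub>i(t), v\<^sub>i(t, f t)) = w\<^sub>i(t, f t)\<close>.  For a fixed point it says that the graph
  is invariant.  Fixed points are unique because the sup-distance \<open>D\<close> of two of them, which
  is finite by boundedness, satisfies \<open>D \<le> \<l> D\<close> with \<open>\<l> < 1\<close>.
\<close>

section \<open>The weighted metric\<close>

text \<open>A metric that is comparable to \<^const>\<open>dist\<close> up to constant factors has the same open sets,
  because each ball of one contains a concentric ball of the other.\<close>

lemma equivalent_metric_on_if_comparable: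
  fixes Z :: "'z::metric_space set"
  assumes "Metric_space Z \<rho>" and "0 < c" and "0 < C"
    and dist_le: "\<And>z w. z \<in> Z \<Longrightarrow> w \<in> Z \<Longrightarrow> dist z w \<le> c * \<rho> z w"
    and le_dist: "\<And>z w. z \<in> Z \<Longrightarrow> w \<in> Z \<Longrightarrow> \<rho> z w \<le> C * dist z w"
  shows "equivalent_metric_on Z \<rho>"
proof -
  interpret Metric_space Z \<rho> by fact
  have "openin mtopology U \<longleftrightarrow> openin (top_of_set Z) U" for U
  proof
    assume U: "openin mtopology U"
    show "openin (top_of_set Z) U"
      unfolding openin_euclidean_subtopology_iff
    proof (intro conjI ballI)
      show "U \<subseteq> Z" using U by (simp add: openin_mtopology)
      fix z assume "z \<in> U"
      with U obtain r where r: "r > 0" "mball z r \<subseteq> U" by (auto simp: openin_mtopology)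
      have "w \<in> U" if w: "w \<in> Z" "dist w z < r / C" for w
      proof -
        have z: "z \<in> Z" using \<open>z \<in> U\<close> \<open>U \<subseteq> Z\<close> by blast
        have "C * dist z w < r"
          using w \<open>0 < C\<close> by (simp add: dist_commute field_simps)
        then have "\<rho> z w < r" using le_dist[OF z w(1)] by linarith
        then show ?thesis using r w z by auto
      qed
      then show "\<exists>e>0. \<forall>w\<in>Z. dist w z < e \<longrightarrow> w \<in> U"
        using r \<open>0 < C\<close> by (intro exI[of _ "r / C"]) auto
    qed
  next
    assume U: "openin (top_of_set Z) U"
    show "openin mtopology U"
      unfolding openin_mtopology
    proof (intro conjI allI impI)
      show UZ: "U \<subseteq> Z" using U by (simp add: openin_euclidean_subtopology_iff)
      fix z assume "z \<in> U"
      with U obtain r where r: "r > 0" "\<And>w. w \<in> Z \<Longrightarrow> dist w z < r \<Longrightarrow> w \<in> U"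
        by (auto simp: openin_euclidean_subtopology_iff)
      have "w \<in> U" if w: "w \<in> mball z (r / c)" for w
      proof -
        have zw: "z \<in> Z" "w \<in> Z" "\<rho> z w < r / c" using w by auto
        then have "c * \<rho> z w < r" using \<open>0 < c\<close> by (simp add: field_simps)
        then have "dist w z < r" using dist_le[of z w] zw by (simp add: dist_commute)
        then show ?thesis using r zw by blast
      qed
      then show "\<exists>r>0. mball z r \<subseteq> U"
        using r \<open>0 < c\<close> by (intro exI[of _ "r / c"]) auto
    qed
  qed
  then show ?thesis
    using assms(1) by (auto simp: equivalent_metric_on_def topology_eq)
qed

lemma dist_le_d_theta:
  assumes "0 < \<theta>"
  shows "dist z w \<le> (1 + 1 / \<theta>) * d_theta \<theta> z w"
proof -
  obtain x1 y1 x2 y2 where zw: "z = (x1, y1)" "w = (x2, y2)" by (metis surj_pair)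
  have "dist z w \<le> dist x1 x2 + dist y1 y2"
    unfolding zw dist_prod_def by (simp add: sqrt_sum_squares_le_sum)
  also have "\<dots> \<le> (dist x1 x2 + dist y1 y2) + (dist x1 x2 / \<theta> + \<theta> * dist y1 y2)"
    using assms by simp
  also have "\<dots> = (1 + 1 / \<theta>) * d_theta \<theta> z w"
    using assms by (simp add: zw d_theta_def field_simps)
  finally show ?thesis .
qed

lemma d_theta_le_dist:
  assumes "0 \<le> \<theta>"
  shows "d_theta \<theta> z w \<le> (1 + \<theta>) * dist z w"
proof -
  have "d_theta \<theta> z w = dist (fst z) (fst w) + \<theta> * dist (snd z) (snd w)"
    by (simp add: d_theta_def case_prod_beta)
  also have "\<dots> \<le> dist z w + \<theta> * dist z w"
    using assms by (intro add_mono mult_left_mono dist_fst_le dist_snd_le) auto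
  finally show ?thesis by (simp add: algebra_simps)
qed

lemma Metric_space_d_theta:
  assumes "0 < \<theta>"
  shows "Metric_space Z (d_theta \<theta>)"
proof
  fix p q r :: "'a \<times> 'b"
  show "0 \<le> d_theta \<theta> p q"
    using assms by (simp add: d_theta_def case_prod_beta)
  show "d_theta \<theta> p q = d_theta \<theta> q p"
    by (simp add: d_theta_def case_prod_beta dist_commute)
  show "d_theta \<theta> p q = 0 \<longleftrightarrow> p = q"
    using assms by (simp add: d_theta_def case_prod_beta prod_eq_iff add_nonneg_eq_0_iff)
  have "d_theta \<theta> p r
      \<le> (dist (fst p) (fst q) + dist (fst q) (fst r))
        + \<theta> * (dist (snd p) (snd q) + dist (snd q) (snd r))"
    unfolding d_theta_def case_prod_beta
    using assms by (intro add_mono mult_left_mono dist_triangle) auto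
  then show "d_theta \<theta> p r \<le> d_theta \<theta> p q + d_theta \<theta> q r"
    by (simp add: d_theta_def case_prod_beta algebra_simps)
qed

lemma equivalent_metric_on_d_theta:
  assumes "0 < \<theta>"
  shows "equivalent_metric_on Z (d_theta \<theta>)"
  using assms
  by (intro equivalent_metric_on_if_comparable[of _ _ "1 + 1 / \<theta>" "1 + \<theta>"]
      Metric_space_d_theta dist_le_d_theta d_theta_le_dist) (auto intro: add_pos_pos)

section \<open>Contractivity of the local IFS\<close>

text \<open>The triangle inequality through \<open>(x2, y1)\<close> changes \<open>x\<close> first and \<open>y\<close> second, using each
  hypothesis on \<open>v\<close> once.  The factor is the larger of the ratios for the two coordinates.\<close>

lemma w_map_contracts_d_theta:
  assumes u: "dist (u i x1) (u i x2) \<le> a * dist x1 x2"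
    and vx: "dist (v i (x1, y1)) (v i (x2, y1)) \<le> L * dist x1 x2"
    and vy: "dist (v i (x2, y1)) (v i (x2, y2)) \<le> \<l> * dist y1 y2"
    and \<theta>: "0 \<le> \<theta>"
  shows "d_theta \<theta> (w_map u v i (x1, y1)) (w_map u v i (x2, y2))
           \<le> max (a + \<theta> * L) \<l> * d_theta \<theta> (x1, y1) (x2, y2)"
proof -
  let ?s = "max (a + \<theta> * L) \<l>"
  have "dist (v i (x1, y1)) (v i (x2, y2)) \<le> L * dist x1 x2 + \<l> * dist y1 y2"
    using dist_triangle[of "v i (x1, y1)" "v i (x2, y2)" "v i (x2, y1)"] vx vy by linarith
  then have "d_theta \<theta> (w_map u v i (x1, y1)) (w_map u v i (x2, y2))
      \<le> a * dist x1 x2 + \<theta> * (L * dist x1 x2 + \<l> * dist y1 y2)"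
    using u \<theta> by (auto simp: d_theta_def w_map_def intro!: add_mono mult_left_mono)
  also have "\<dots> = (a + \<theta> * L) * dist x1 x2 + \<l> * (\<theta> * dist y1 y2)"
    by (simp add: algebra_simps)
  also have "\<dots> \<le> ?s * dist x1 x2 + ?s * (\<theta> * dist y1 y2)"
    using \<theta> by (intro add_mono mult_right_mono) auto
  finally show ?thesis by (simp add: d_theta_def algebra_simps)
qed

lemma continuous_on_if_d_theta_lipschitz:
  assumes "0 < \<theta>" and "0 \<le> s"
    and contr: "\<And>z w. z \<in> S \<Longrightarrow> w \<in> S \<Longrightarrow> d_theta \<theta> (g z) (g w) \<le> s * d_theta \<theta> z w"
  shows "continuous_on S g"
proof -
  let ?c = "1 + 1 / \<theta>" and ?C = "1 + \<theta>"
  have "(?c * (s * ?C))-lipschitz_on S g"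
  proof (rule lipschitz_onI)
    fix z w assume zw: "z \<in> S" "w \<in> S"
    have "dist (g z) (g w) \<le> ?c * d_theta \<theta> (g z) (g w)"
      using \<open>0 < \<theta>\<close> by (rule dist_le_d_theta)
    also have "\<dots> \<le> ?c * (s * d_theta \<theta> z w)"
      using \<open>0 < \<theta>\<close> contr[OF zw] by (intro mult_left_mono) auto
    also have "\<dots> \<le> ?c * (s * (?C * dist z w))"
      using \<open>0 < \<theta>\<close> \<open>0 \<le> s\<close> d_theta_le_dist[of \<theta> z w] by (intro mult_left_mono) auto
    finally show "dist (g z) (g w) \<le> ?c * (s * ?C) * dist z w" by (simp add: mult.assoc)
  qed (use \<open>0 < \<theta>\<close> \<open>0 \<le> s\<close> in auto)
  then show ?thesis by (rule lipschitz_on_continuous_on)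
qed

section \<open>The Read-Bajactarevic operator\<close>

lemma RB_operator_apply:
  assumes i: "i \<in> {1..N}" "t \<in> Xs i" and "u i t \<in> X" and "inj_on (u i) (Xs i)"
    and disj: "disjoint_family_on (\<lambda>j. u j ` Xs j) {1..N}"
  shows "RB_operator X N Xs u v f (u i t) = v i (t, f t)"
proof -
  have "(THE j. j \<in> {1..N} \<and> u i t \<in> u j ` Xs j) = i"
    by (intro the_equality) (use i disj in \<open>unfold disjoint_family_on_def, blast+\<close>)
  then show ?thesis
    using assms by (simp add: RB_operator_def Let_def the_inv_into_f_f)
qed

text \<open>Each point of \<open>X\<close> is \<open>u\<^sub>i(t)\<close> for exactly one \<open>i\<close> and \<open>t\<close>, so both sides can be parametrized by
  these pairs and compared point by point.\<close>

lemma graph_on_RB_operator: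
  assumes cover: "X = (\<Union>i\<in>{1..N}. u i ` Xs i)"
    and sub: "\<And>i. i \<in> {1..N} \<Longrightarrow> Xs i \<subseteq> X"
    and inj: "\<And>i. i \<in> {1..N} \<Longrightarrow> inj_on (u i) (Xs i)"
    and disj: "disjoint_family_on (\<lambda>i. u i ` Xs i) {1..N}"
  shows "graph_on X (RB_operator X N Xs u v f)
           = local_IFS_operator N (\<lambda>i. Xs i \<times> UNIV) (w_map u v) (graph_on X f)"
proof -
  have "graph_on X (RB_operator X N Xs u v f)
      = (\<Union>i\<in>{1..N}. (\<lambda>t. (u i t, RB_operator X N Xs u v f (u i t))) ` Xs i)"
    unfolding graph_on_def using cover by auto
  also have "\<dots> = (\<Union>i\<in>{1..N}. (\<lambda>t. w_map u v i (t, f t)) ` Xs i)"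
  proof (intro SUP_cong refl image_cong)
    fix i t assume it: "i \<in> {1..N}" "t \<in> Xs i"
    then have "u i t \<in> X" using cover by blast
    then show "(u i t, RB_operator X N Xs u v f (u i t)) = w_map u v i (t, f t)"
      using it inj disj by (simp add: RB_operator_apply w_map_def)
  qed
  also have "\<dots> = (\<Union>i\<in>{1..N}. w_map u v i ` (graph_on X f \<inter> Xs i \<times> UNIV))"
  proof (intro SUP_cong refl)
    fix i assume "i \<in> {1..N}"
    then have "graph_on X f \<inter> Xs i \<times> UNIV = (\<lambda>t. (t, f t)) ` Xs i"
      using sub by (auto simp: graph_on_def)
    then show "(\<lambda>t. w_map u v i (t, f t)) ` Xs i
        = w_map u v i ` (graph_on X f \<inter> Xs i \<times> UNIV)"
      by (simp add: image_image)
  qed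
  finally show ?thesis by (simp add: local_IFS_operator_def)
qed

text \<open>Two fixed points agree because their distance at \<open>u\<^sub>i(t)\<close> is at most \<open>\<l>\<close> times their distance at
  \<open>t\<close>, hence at most \<open>\<l>\<close> times the supremum of all distances; boundedness makes that supremum finite.\<close>

lemma RB_operator_fixed_point_unique:
  fixes f g :: "'a \<Rightarrow> 'b::metric_space"
  assumes f: "f \<in> bounded_functions X" "RB_operator X N Xs u v f = f"
    and g: "g \<in> bounded_functions X" "RB_operator X N Xs u v g = g"
    and cover: "X = (\<Union>i\<in>{1..N}. u i ` Xs i)"
    and sub: "\<And>i. i \<in> {1..N} \<Longrightarrow> Xs i \<subseteq> X"
    and inj: "\<And>i. i \<in> {1..N} \<Longrightarrow> inj_on (u i) (Xs i)"
    and disj: "disjoint_family_on (\<lambda>i. u i ` Xs i) {1..N}"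
    and \<l>: "0 \<le> \<l>" "\<l> < 1"
    and contr: "\<And>i x y1 y2. i \<in> {1..N} \<Longrightarrow> x \<in> Xs i \<Longrightarrow>
           dist (v i (x, y1)) (v i (x, y2)) \<le> \<l> * dist y1 y2"
  shows "f = g"
proof (rule extensionalityI)
  show "f \<in> extensional X" "g \<in> extensional X"
    using f g by (auto simp: bounded_functions_def)
  fix x0 assume "x0 \<in> X"
  define D where "D = (SUP x\<in>X. dist (f x) (g x))"
  have "bounded (f ` X \<union> g ` X)" using f g by (simp add: bounded_functions_def)
  then obtain B where "\<forall>p\<in>f ` X \<union> g ` X. \<forall>q\<in>f ` X \<union> g ` X. dist p q \<le> B"
    by (metis bounded_two_points)
  then have "bdd_above ((\<lambda>x. dist (f x) (g x)) ` X)" by (intro bdd_aboveI[of _ B]) blast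
  then have le_D: "dist (f x) (g x) \<le> D" if "x \<in> X" for x
    unfolding D_def using that by (rule cSUP_upper2) auto
  have "dist (f x) (g x) \<le> \<l> * D" if "x \<in> X" for x
  proof -
    obtain i t where it: "i \<in> {1..N}" "t \<in> Xs i" "x = u i t" using \<open>x \<in> X\<close> cover by blast
    then have "RB_operator X N Xs u v h x = v i (t, h t)" for h
      using \<open>x \<in> X\<close> inj disj by (simp add: RB_operator_apply)
    then have "f x = v i (t, f t)" "g x = v i (t, g t)" using f(2) g(2) by metis+
    then have "dist (f x) (g x) \<le> \<l> * dist (f t) (g t)" using contr it by simp
    also have "\<dots> \<le> \<l> * D" using it sub \<l> by (intro mult_left_mono le_D) auto
    finally show ?thesis .
  qed
  then have "D \<le> \<l> * D"
    unfolding D_def using \<open>x0 \<in> X\<close> by (intro cSUP_least) auto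
  then have "(1 - \<l>) * D \<le> 0" by (simp add: algebra_simps)
  then have "D \<le> 0" using \<l> by (simp add: mult_le_0_iff)
  then have "dist (f x0) (g x0) \<le> 0" using le_D[OF \<open>x0 \<in> X\<close>] by linarith
  then show "f x0 = g x0" by simp
qed

section \<open>The graph of the local fractal function as an attractor\<close>

theorem theorem3p7:
  fixes N :: nat
    and X :: "'a::complete_space set"
    and Xs :: "nat \<Rightarrow> 'a set"
    and u :: "nat \<Rightarrow> 'a \<Rightarrow> 'a"
    and v :: "nat \<Rightarrow> 'a \<times> 'b::complete_space \<Rightarrow> 'b"
    and \<alpha> :: "nat \<Rightarrow> real"
    and a \<l> L \<theta> :: real
  assumes "1 < N"
    and "X \<noteq> {}" and "connected X" and "closed X"
    and "\<And>i. i \<in> {1..N} \<Longrightarrow> Xs i \<noteq> {} \<and> connected (Xs i) \<and> Xs i \<subseteq> X"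
    and "\<And>i. i \<in> {1..N} \<Longrightarrow> u i ` Xs i \<subseteq> X"
    and "\<And>i. i \<in> {1..N} \<Longrightarrow> (\<alpha> i)-lipschitz_on (Xs i) (u i)"
    and "\<And>i. i \<in> {1..N} \<Longrightarrow> inj_on (u i) (Xs i)"
    and "X = (\<Union>i\<in>{1..N}. u i ` Xs i)"
    and "\<And>i j. i \<in> {1..N} \<Longrightarrow> j \<in> {1..N} \<Longrightarrow> i \<noteq> j \<Longrightarrow> u i ` Xs i \<inter> u j ` Xs j = {}"
    and "a = Max (\<alpha> ` {1..N})" and "a < 1"
    and "0 \<le> \<l>" and "\<l> < 1" and "0 < L"
    and "\<And>i x y1 y2. i \<in> {1..N} \<Longrightarrow> x \<in> Xs i \<Longrightarrow>
           dist (v i (x, y1)) (v i (x, y2)) \<le> \<l> * dist y1 y2"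
    and "\<And>i x1 x2 y. i \<in> {1..N} \<Longrightarrow> x1 \<in> Xs i \<Longrightarrow> x2 \<in> Xs i \<Longrightarrow>
           dist (v i (x1, y)) (v i (x2, y)) \<le> L * dist x1 x2"
    and "\<theta> = (1 - a) / (2 * L)"
  shows "contractive_local_IFS_in (X \<times> (UNIV :: 'b set)) N (\<lambda>i. Xs i \<times> UNIV) (w_map u v) (d_theta \<theta>) \<and>
    (\<forall>fstar \<in> bounded_functions X. RB_operator X N Xs u v fstar = fstar \<longrightarrow>
       (\<forall>g \<in> bounded_functions X. RB_operator X N Xs u v g = g \<longrightarrow> g = fstar) \<and>
       local_IFS_attractor (X \<times> (UNIV :: 'b set)) N (\<lambda>i. Xs i \<times> UNIV) (w_map u v) (graph_on X fstar) \<and>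
       graph_on X (RB_operator X N Xs u v fstar)
         = local_IFS_operator N (\<lambda>i. Xs i \<times> UNIV) (w_map u v) (graph_on X fstar))"
proof -
  note closed = assms(4) and dom = assms(5) and into = assms(6) and lip = assms(7) and inj = assms(8)
    and cover = assms(9) and a_def = assms(11) and a_less = assms(12) and \<l> = assms(13,14)
    and L_pos = assms(15) and v_contr = assms(16) and v_lip = assms(17) and \<theta>_def = assms(18)
  have sub: "\<And>i. i \<in> {1..N} \<Longrightarrow> Xs i \<subseteq> X" using dom by blast
  have disj: "disjoint_family_on (\<lambda>i. u i ` Xs i) {1..N}"
    using assms(10) by (simp add: disjoint_family_on_def)
  have \<theta>_pos: "0 < \<theta>" using a_less L_pos by (simp add: \<theta>_def)
  define s where "s = max (a + \<theta> * L) \<l>"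
  have s: "0 \<le> s" "s < 1"
    using \<l> a_less L_pos by (auto simp: s_def \<theta>_def field_simps)
  have contr: "d_theta \<theta> (w_map u v i z) (w_map u v i w) \<le> s * d_theta \<theta> z w"
    if i: "i \<in> {1..N}" and zw_in: "z \<in> Xs i \<times> UNIV" "w \<in> Xs i \<times> UNIV" for i z w
  proof -
    obtain x1 y1 x2 y2 where zw: "z = (x1, y1)" "w = (x2, y2)" "x1 \<in> Xs i" "x2 \<in> Xs i"
      using zw_in by (metis SigmaE)
    have "\<alpha> i \<le> a" unfolding a_def using i by simp
    then have "dist (u i x1) (u i x2) \<le> a * dist x1 x2"
      using lipschitz_onD[OF lip[OF i] zw(3,4)] by (meson mult_right_mono order_trans zero_le_dist)
    then show ?thesis
      unfolding zw(1,2) s_def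
      using i zw \<theta>_pos v_lip v_contr by (intro w_map_contracts_d_theta) auto
  qed
  have "local_IFS (X \<times> (UNIV :: 'b set)) N (\<lambda>i. Xs i \<times> UNIV) (w_map u v)"
    unfolding local_IFS_def
  proof (intro conjI ballI)
    show "complete (X \<times> (UNIV :: 'b set))"
      using closed by (simp add: complete_eq_closed closed_Times)
    fix i assume i: "i \<in> {1..N}"
    show "Xs i \<times> (UNIV :: 'b set) \<subseteq> X \<times> UNIV" "Xs i \<times> (UNIV :: 'b set) \<noteq> {}"
      using dom[OF i] by auto
    show "w_map u v i ` (Xs i \<times> UNIV) \<subseteq> X \<times> UNIV"
      using into[OF i] by (auto simp: w_map_def)
    show "continuous_on (Xs i \<times> UNIV) (w_map u v i)"
      using \<theta>_pos s(1) contr[OF i] by (rule continuous_on_if_d_theta_lipschitz)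
  qed
  moreover have "equivalent_metric_on (X \<times> (UNIV :: 'b set)) (d_theta \<theta>)"
    using \<theta>_pos by (rule equivalent_metric_on_d_theta)
  ultimately have IFS: "contractive_local_IFS_in (X \<times> (UNIV :: 'b set)) N (\<lambda>i. Xs i \<times> UNIV)
      (w_map u v) (d_theta \<theta>)"
    unfolding contractive_local_IFS_in_def using s contr by blast
  have graph: "graph_on X (RB_operator X N Xs u v f)
      = local_IFS_operator N (\<lambda>i. Xs i \<times> UNIV) (w_map u v) (graph_on X f)" for f
    using cover sub inj disj by (rule graph_on_RB_operator)
  have attractor: "local_IFS_attractor (X \<times> UNIV) N (\<lambda>i. Xs i \<times> UNIV) (w_map u v) (graph_on X f)"
    if "RB_operator X N Xs u v f = f" for f
    using graph[of f] that by (auto simp: local_IFS_attractor_def graph_on_def)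
  have unique: "g = f"
    if "f \<in> bounded_functions X" "RB_operator X N Xs u v f = f"
      "g \<in> bounded_functions X" "RB_operator X N Xs u v g = g" for f g
    using RB_operator_fixed_point_unique[OF that(3,4,1,2) cover sub inj disj \<l> v_contr] by blast
  show ?thesis using IFS graph attractor unique by blast
qed

end
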